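(* Let $0<\beta<1$ and $f(t)=t^\beta$. Let $i,j$ be two jobs with $p_j\le p_i$ and $w_i/w_j\ge (p_i/p_j)^{2-\beta}$. If $i\prec_\ell j$, then $i\prec_g j$.
   Context: Let $f(t)=t^\beta$ for $t\ge 0$. A job $k$ has a processing time $p_k>0$ and a weight $w_k>0$. An instance is a finite set of jobs; a schedule is an ordering of all jobs of the instance, processed consecutively without idle time from time $0$ on a single machine; the completion time $C_k$ of job $k$ is the sum of the processing times of $k$ and of all jobs preceding it; the cost of a schedule $S$ is $F(S)=\sum_k w_k f(C_k)$, and a schedule is optimal if it minimizes $F$. Standing assumption: within an instance no two jobs have the same processing time, the same weight, or the same ratio $w_k/p_k$. Local order: $i\prec_\ell j$ means that for every $t\ge 0$, $w_j\big(f(t+p_i+p_j)-f(t+p_j)\big) < w_i\big(f(t+p_i+p_j)-f(t+p_i)\big)$. Global order: $i\prec_g j$ means that for every instance containing $i$ and $j$ (together with arbitrary other jobs), every optimal schedule processes $i$ before $j$. *)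

theory Defs
  imports "HOL-Analysis.Analysis" "HOL-Combinatorics.Multiset_Permutations"
begin

(* A job is identified with its pair (processing time, weight): jobs of one instance are
   required to differ in both parameters, so no two of them are ever confused. *)
datatype job = Job (ptime: real) (weight: real)

definition is_job :: "job \<Rightarrow> bool" where
  "is_job k \<longleftrightarrow> ptime k > 0 \<and> weight k > 0"

definition is_instance :: "job set \<Rightarrow> bool" where
  "is_instance I \<longleftrightarrow> finite I \<and> (\<forall>k\<in>I. is_job k) \<and>
     (\<forall>k\<in>I. \<forall>l\<in>I. k \<noteq> l \<longrightarrow>
        ptime k \<noteq> ptime l \<and> weight k \<noteq> weight l \<and>
        weight k / ptime k \<noteq> weight l / ptime l)"

(* Schedules of I are the elements of permutations_of_set I: lists enumerating I without
   repetition, in processing order. *)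
definition precedes :: "job list \<Rightarrow> job \<Rightarrow> job \<Rightarrow> bool" where
  "precedes S k l \<longleftrightarrow> (\<exists>xs ys zs. S = xs @ k # ys @ l # zs)"

definition completion_time :: "job list \<Rightarrow> job \<Rightarrow> real" where
  "completion_time S k = ptime k + (\<Sum>l | precedes S l k. ptime l)"

definition cost :: "(real \<Rightarrow> real) \<Rightarrow> job list \<Rightarrow> real" where
  "cost f S = (\<Sum>k\<in>set S. weight k * f (completion_time S k))"

definition optimal :: "(real \<Rightarrow> real) \<Rightarrow> job set \<Rightarrow> job list \<Rightarrow> bool" where
  "optimal f I S \<longleftrightarrow> S \<in> permutations_of_set I \<and>
     (\<forall>S'\<in>permutations_of_set I. cost f S \<le> cost f S')"

definition local_before :: "(real \<Rightarrow> real) \<Rightarrow> job \<Rightarrow> job \<Rightarrow> bool" where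
  "local_before f i j \<longleftrightarrow> (\<forall>t\<ge>0.
     weight j * (f (t + ptime i + ptime j) - f (t + ptime j))
       < weight i * (f (t + ptime i + ptime j) - f (t + ptime i)))"

definition global_before :: "(real \<Rightarrow> real) \<Rightarrow> job \<Rightarrow> job \<Rightarrow> bool" where
  "global_before f i j \<longleftrightarrow> (\<forall>I S.
     is_instance I \<and> i \<in> I \<and> j \<in> I \<and> optimal f I S \<longrightarrow> precedes S i j)"

end

(* Suppose an optimal schedule has the form A j B i C and write a, b for the total processing times
   of A and B, T = a + b + p_i + p_j, and g(x) for the cost of the jobs of B when B starts at a + x.
   Comparing with A i B j C bounds g(p_i) - g(p_j) from below, and comparing with A B i j C bounds
   g(p_j) - g(0) from above.  As f is concave, p_j (g(p_i) - g(p_j)) <= (p_i - p_j) (g(p_j) - g(0)),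
   so that phi(T) <= 0 for
     phi(T) = w_i (p_j (f(T) - f(a + p_i)) + (p_i - p_j) (f(T) - f(T - p_j)))
              - w_j p_i (f(T) - f(a + p_j)).
   For b = 0 the local order says exactly that phi(T) > 0, and the lower bound on w_i / w_j
   makes phi nondecreasing on T >= p_i + p_j, which is a contradiction. *)

theory Submission
  imports Defs
begin

text \<open>\<open>cost\<close> reads completion times off the whole list. Carrying the start time
  instead lets the cost split along \<open>@\<close> and lets one block be compared at several start
  times.\<close>

fun cost_from :: "(real \<Rightarrow> real) \<Rightarrow> real \<Rightarrow> job list \<Rightarrow> real" where
  "cost_from f t [] = 0"
| "cost_from f t (k # ks) = weight k * f (t + ptime k) + cost_from f (t + ptime k) ks"

lemma cost_from_append:
  "cost_from f t (xs @ ys) = cost_from f t xs + cost_from f (t + sum_list (map ptime xs)) ys"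
  by (induction xs arbitrary: t) (auto simp: algebra_simps)

lemma precedes_iff_mem_prefix:
  assumes "distinct (xs @ k # ys)"
  shows "precedes (xs @ k # ys) l k \<longleftrightarrow> l \<in> set xs"
proof
  assume "precedes (xs @ k # ys) l k"
  then obtain as bs cs where eq: "xs @ k # ys = (as @ l # bs) @ k # cs"
    by (auto simp: precedes_def)
  moreover from this have "k \<notin> set (as @ l # bs)"
    using assms by (metis distinct_append disjoint_iff list.set_intros(1))
  ultimately have "xs = as @ l # bs"
    using assms by (subst (asm) append_Cons_eq_iff) auto
  then show "l \<in> set xs" by simp
next
  assume "l \<in> set xs"
  then obtain as bs where "xs = as @ l # bs" by (meson split_list)
  then show "precedes (xs @ k # ys) l k" by (auto simp: precedes_def)
qed

lemma completion_time_append: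
  assumes "distinct (xs @ k # ys)"
  shows "completion_time (xs @ k # ys) k = sum_list (map ptime xs) + ptime k"
  using assms
  by (simp add: completion_time_def precedes_iff_mem_prefix[OF assms]
      sum_list_distinct_conv_sum_set)

text \<open>The prefix \<open>xs\<close> is general so that the induction can move the jobs of
  \<open>ys\<close> into it one by one, while the whole schedule stays fixed.\<close>

lemma sum_completion_time_eq_cost_from:
  assumes "distinct (xs @ ys)"
  shows "(\<Sum>k\<in>set ys. weight k * f (completion_time (xs @ ys) k))
    = cost_from f (sum_list (map ptime xs)) ys"
  using assms
proof (induction ys arbitrary: xs)
  case (Cons k ys)
  then show ?case
    using Cons.IH[of "xs @ [k]"] by (simp add: completion_time_append)
qed simp

lemma cost_eq_cost_from: "distinct S \<Longrightarrow> cost f S = cost_from f 0 S"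
  using sum_completion_time_eq_cost_from[of "[]" S f] by (simp add: cost_def)

lemma not_precedes_split:
  assumes "i \<in> set S" "j \<in> set S" "i \<noteq> j" "\<not> precedes S i j"
  obtains A B C where "S = A @ j # B @ i # C"
proof -
  obtain A R where S: "S = A @ j # R"
    using assms(2) by (meson split_list)
  have "i \<notin> set A"
  proof
    assume "i \<in> set A"
    then obtain xs ys where "A = xs @ i # ys" by (meson split_list)
    then have "S = xs @ i # ys @ j # R" using S by simp
    then show False using assms(4) by (auto simp: precedes_def)
  qed
  then have "i \<in> set R" using assms S by auto
  then obtain B C where "R = B @ i # C" by (meson split_list)
  then show thesis using S that by simp
qed

text \<open>The point \<open>u + p\<close> divides the segment from \<open>u\<close> to
  \<open>u + q\<close> in the ratio \<open>p\<close> to \<open>q - p\<close>. Concavity there,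
  multiplied by \<open>q\<close>, rearranges to this form.\<close>

lemma concave_on_three_points:
  fixes f :: "real \<Rightarrow> real"
  assumes "concave_on {0<..} f" "0 < u" "0 < p" "p \<le> q"
  shows "p * (f (u + q) - f (u + p)) \<le> (q - p) * (f (u + p) - f u)"
proof -
  define t where "t = p / q"
  have q: "0 < q" using assms by simp
  have t: "0 \<le> t" "t \<le> 1" and p: "p = t * q" using assms by (auto simp: t_def)
  have "(1 - t) * f u + t * f (u + q) \<le> f ((1 - t) *\<^sub>R u + t *\<^sub>R (u + q))"
    using assms t by (intro concave_onD) auto
  also have "(1 - t) *\<^sub>R u + t *\<^sub>R (u + q) = u + p"
    by (simp add: p algebra_simps)
  finally have "q * ((1 - t) * f u + t * f (u + q)) \<le> q * f (u + p)"
    using q by simp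
  then show ?thesis by (simp add: p algebra_simps)
qed

text \<open>Delaying a block delays each of its jobs equally, so the three-point inequality can be
  summed with the weights. The start \<open>u = 0\<close> is harmless, as completion times are still
  positive.\<close>

lemma cost_from_shift:
  assumes "concave_on {0<..} f" "\<forall>k\<in>set ks. is_job k" "0 \<le> u" "0 < p" "p \<le> q"
  shows "p * (cost_from f (u + q) ks - cost_from f (u + p) ks)
    \<le> (q - p) * (cost_from f (u + p) ks - cost_from f u ks)"
  using assms(2,3)
proof (induction ks arbitrary: u)
  case (Cons k ks)
  let ?v = "u + ptime k"
  have k: "0 < ptime k" "0 < weight k" using Cons.prems by (auto simp: is_job_def)
  have "weight k * (p * (f (?v + q) - f (?v + p))) \<le> weight k * ((q - p) * (f (?v + p) - f ?v))"
    using concave_on_three_points[OF assms(1) _ assms(4,5), of ?v] k Cons.prems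
    by (intro mult_left_mono) auto
  moreover have "p * (cost_from f (?v + q) ks - cost_from f (?v + p) ks)
    \<le> (q - p) * (cost_from f (?v + p) ks - cost_from f ?v ks)"
    using Cons.IH[of ?v] Cons.prems k by simp
  ultimately show ?case by (simp add: algebra_simps)
qed simp

lemma concave_on_powr:
  fixes \<beta> :: real
  assumes "0 < \<beta>" "\<beta> < 1"
  shows "concave_on {0<..} (\<lambda>x. x powr \<beta>)"
proof (rule f''_le0_imp_concave)
  fix x :: real assume "x \<in> {0<..}"
  then have x: "0 < x" by simp
  show "((\<lambda>x. x powr \<beta>) has_real_derivative \<beta> * x powr (\<beta> - 1)) (at x)"
    using x by (rule has_real_derivative_powr)
  show "((\<lambda>x. \<beta> * x powr (\<beta> - 1)) has_real_derivative
      \<beta> * ((\<beta> - 1) * x powr (\<beta> - 1 - 1))) (at x)"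
    using x by (intro DERIV_cmult has_real_derivative_powr)
  show "\<beta> * ((\<beta> - 1) * x powr (\<beta> - 1 - 1)) \<le> 0"
    using assms by (intro mult_nonneg_nonpos mult_nonpos_nonneg) auto
qed simp

text \<open>Weighted AM-GM for \<open>T - p\<close> and \<open>T\<close>, divided by
  \<open>T powr (1 - \<beta>)\<close>. It controls the derivative of
  \<open>T powr \<beta> - (T - p) powr \<beta>\<close>.\<close>

lemma powr_diff_bound:
  fixes \<beta> p T :: real
  assumes "0 < \<beta>" "\<beta> < 1" "0 < p" "p < T"
  shows "(T - p) * ((T - p) powr (\<beta> - 1) - T powr (\<beta> - 1)) \<le> (1 - \<beta>) * p * T powr (\<beta> - 1)"
proof -
  define X where "X = T powr (\<beta> - 1)"
  have X: "X > 0" "T powr (1 - \<beta>) * X = 1"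
    using assms by (auto simp: X_def simp flip: powr_add)
  have Y: "(T - p) powr \<beta> = (T - p) * (T - p) powr (\<beta> - 1)"
    using assms by (simp add: powr_mult_base)
  have "(T - p) powr \<beta> * T powr (1 - \<beta>) \<le> \<beta> * (T - p) + (1 - \<beta>) * T"
    using assms by (intro Youngs_inequality_0) auto
  then have "((T - p) powr \<beta> * T powr (1 - \<beta>)) * X \<le> (\<beta> * (T - p) + (1 - \<beta>) * T) * X"
    using X by (intro mult_right_mono) auto
  then have "(T - p) powr \<beta> \<le> (\<beta> * (T - p) + (1 - \<beta>) * T) * X"
    using X by (simp add: mult.assoc)
  then show ?thesis by (simp add: Y X_def[symmetric] algebra_simps)
qed

text \<open>Weighted AM-GM for \<open>q\<close> and \<open>p\<close> replaces the powers by a linear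
  expression. The exponent \<open>2 - \<beta>\<close> is the one for which the powers multiply to
  exactly \<open>q * q\<close>.\<close>

lemma weight_ratio_bound:
  fixes \<beta> p q v w :: real
  assumes "0 < \<beta>" "\<beta> < 1" "0 < p" "0 < q" "0 < v" "0 < w"
    and "(q / p) powr (2 - \<beta>) \<le> w / v"
  shows "v * q * q \<le> w * p * (\<beta> * q + (1 - \<beta>) * p)"
proof -
  have "q powr \<beta> * p powr (1 - \<beta>) \<le> \<beta> * q + (1 - \<beta>) * p"
    using assms by (intro Youngs_inequality_0) auto
  moreover have "v * (q / p) powr (2 - \<beta>) \<le> w"
    using assms by (simp add: field_simps)
  ultimately have "(v * (q / p) powr (2 - \<beta>)) * (p * (q powr \<beta> * p powr (1 - \<beta>)))
      \<le> w * (p * (\<beta> * q + (1 - \<beta>) * p))"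
    using assms by (intro mult_mono) auto
  moreover have "(q / p) powr (2 - \<beta>) * (p * (q powr \<beta> * p powr (1 - \<beta>))) = q * q"
  proof -
    have "p * p powr (1 - \<beta>) = p powr (2 - \<beta>)"
      using assms by (simp add: powr_mult_base)
    moreover have "q powr (2 - \<beta>) * q powr \<beta> = q * q"
      using assms by (simp add: power2_eq_square flip: powr_add)
    moreover have "(q / p) powr (2 - \<beta>) * (p * (q powr \<beta> * p powr (1 - \<beta>)))
        = (q powr (2 - \<beta>) * q powr \<beta>) * (p * p powr (1 - \<beta>)) / p powr (2 - \<beta>)"
      using assms by (simp add: powr_divide)
    ultimately show ?thesis using assms by simp
  qed
  ultimately show ?thesis by (simp add: mult.assoc)
qed

text \<open>The derivative of \<open>\<phi>\<close> is shown to be nonnegative. Here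
  \<open>a\<close> and \<open>b\<close> stand for constant values of the cost function, which vanish
  on differentiation.\<close>

lemma gain_mono:
  fixes \<beta> p q v w a b S T :: real
  assumes "0 < \<beta>" "\<beta> < 1" "0 < p" "p \<le> q" "0 < v" "0 < w"
    and ratio: "(q / p) powr (2 - \<beta>) \<le> w / v"
    and "p + q \<le> S" "S \<le> T"
  defines "\<phi> \<equiv> \<lambda>T. w * (p * (T powr \<beta> - a) + (q - p) * (T powr \<beta> - (T - p) powr \<beta>))
      - v * q * (T powr \<beta> - b)"
  shows "\<phi> S \<le> \<phi> T"
proof (rule DERIV_nonneg_imp_nondecreasing[OF \<open>S \<le> T\<close>])
  fix t assume "S \<le> t" "t \<le> T"
  then have t: "0 < t" "q \<le> t - p" using assms by auto
  define X Y where "X = t powr (\<beta> - 1)" and "Y = (t - p) powr (\<beta> - 1)"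
  let ?D = "w * (p * X + (q - p) * (X - Y)) - v * q * X"
  have "X > 0" using t by (simp add: X_def)
  have "X \<le> Y" unfolding X_def Y_def using assms t by (intro powr_mono2') auto
  \<comment> \<open>The bound \<open>p + q \<le> S\<close> enters here, through
    \<open>q \<le> t - p\<close>.\<close>
  have "q * (Y - X) \<le> (t - p) * (Y - X)"
    using t \<open>X \<le> Y\<close> by (intro mult_right_mono) auto
  also have "\<dots> \<le> (1 - \<beta>) * p * X"
    unfolding X_def Y_def using assms t by (intro powr_diff_bound) auto
  finally have "(w * (q - p)) * (q * (Y - X)) \<le> (w * (q - p)) * ((1 - \<beta>) * p * X)"
    using assms by (intro mult_left_mono) auto
  moreover have "(v * q * q) * X \<le> (w * p * (\<beta> * q + (1 - \<beta>) * p)) * X"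
    using assms \<open>X > 0\<close> by (intro mult_right_mono weight_ratio_bound) auto
  \<comment> \<open>The bounds fit without slack: \<open>q - (1 - \<beta>) * (q - p) = \<beta> * q +
    (1 - \<beta>) * p\<close>.\<close>
  ultimately have "0 \<le> q * ?D" by (simp add: algebra_simps)
  then have "0 \<le> ?D" using assms by (simp add: zero_le_mult_iff)
  moreover have "(\<phi> has_real_derivative \<beta> * ?D) (at t)"
    unfolding \<phi>_def X_def Y_def using t assms
    by (auto intro!: derivative_eq_intros simp: algebra_simps)
  ultimately show "\<exists>y. (\<phi> has_real_derivative y) (at t) \<and> 0 \<le> y"
    using assms by (intro exI[of _ "\<beta> * ?D"]) auto
qed

theorem theorem3:
  fixes \<beta> :: real and f :: "real \<Rightarrow> real" and i j :: job
  assumes "0 < \<beta>" and "\<beta> < 1"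
    and "\<And>t. t \<ge> 0 \<Longrightarrow> f t = t powr \<beta>"
    and "is_job i" and "is_job j"
    and "ptime j \<le> ptime i"
    and "weight i / weight j \<ge> (ptime i / ptime j) powr (2 - \<beta>)"
    and "local_before f i j"
  shows "global_before f i j"
  unfolding global_before_def
proof (intro allI impI)
  fix I S
  assume *: "is_instance I \<and> i \<in> I \<and> j \<in> I \<and> optimal f I S"
  define p q v w where "p = ptime j" and "q = ptime i" and "v = weight j" and "w = weight i"
  note defs = p_def q_def v_def w_def
  have pos: "0 < p" "p \<le> q" "0 < v" "0 < w"
    using assms(4-6) by (auto simp: defs is_job_def)
  \<comment> \<open>For equal jobs the strict inequality of the local order would have identical
    sides.\<close>
  have "i \<noteq> j"
    using assms(8) by (auto simp: local_before_def)
  have S: "set S = I" "distinct S"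
    and opt: "\<And>S'. set S' = I \<Longrightarrow> distinct S' \<Longrightarrow> cost_from f 0 S \<le> cost_from f 0 S'"
    using * by (auto simp: optimal_def permutations_of_set_def simp flip: cost_eq_cost_from)
  show "precedes S i j"
  proof (rule ccontr)
    assume "\<not> precedes S i j"
    then obtain A B C where split: "S = A @ j # B @ i # C"
      using not_precedes_split[of i S j] * S \<open>i \<noteq> j\<close> by auto
    have jobs: "\<forall>k\<in>set S. is_job k"
      using * S by (simp add: is_instance_def)
    define a b where "a = sum_list (map ptime A)" and "b = sum_list (map ptime B)"
    define T where "T = a + b + p + q"
    define g where "g x = cost_from f (a + x) B" for x
    have "0 \<le> a" "0 \<le> b"
      unfolding a_def b_def using jobs split
      by (auto intro!: sum_list_nonneg simp: is_job_def less_imp_le)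
    \<comment> \<open>The jobs of \<open>A\<close> and \<open>C\<close> keep their completion times
      in both rearrangements, so only \<open>i\<close>, \<open>j\<close> and \<open>B\<close>
      matter.\<close>
    have "cost_from f 0 S \<le> cost_from f 0 (A @ i # B @ j # C)"
      using S split by (intro opt) auto
    then have swap: "w * (f T - f (a + q)) - v * (f T - f (a + p)) \<le> g q - g p"
      by (simp add: split cost_from_append a_def[symmetric] b_def[symmetric] g_def T_def
          defs[symmetric] algebra_simps)
    have "cost_from f 0 S \<le> cost_from f 0 (A @ B @ i # j # C)"
      using S split by (intro opt) auto
    then have postpone: "g p - g 0 \<le> v * (f T - f (a + p)) - w * (f T - f (T - p))"
      by (simp add: split cost_from_append a_def[symmetric] b_def[symmetric] g_def T_def
          defs[symmetric] algebra_simps)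
    have "concave_on {0<..} f"
      using concave_on_powr[OF assms(1,2)] assms(3) by (simp add: concave_on_iff)
    then have "p * (g q - g p) \<le> (q - p) * (g p - g 0)"
      using cost_from_shift[of f B a p q] jobs split pos \<open>0 \<le> a\<close> by (simp add: g_def)
    moreover have "p * (w * (f T - f (a + q)) - v * (f T - f (a + p))) \<le> p * (g q - g p)"
      using swap pos by (intro mult_left_mono) auto
    moreover have "(q - p) * (g p - g 0)
        \<le> (q - p) * (v * (f T - f (a + p)) - w * (f T - f (T - p)))"
      using postpone pos by (intro mult_left_mono) auto
    ultimately have upper: "w * (p * (f T - f (a + q)) + (q - p) * (f T - f (T - p)))
        - v * q * (f T - f (a + p)) \<le> 0"
      by (simp add: algebra_simps)
    let ?R = "a + p + q"
    have "v * (f ?R - f (a + p)) < w * (f ?R - f (a + q))"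
      using assms(8) \<open>0 \<le> a\<close> by (simp add: local_before_def defs add_ac)
    \<comment> \<open>Since \<open>?R - p = a + q\<close>, both differences weighted by
      \<open>p\<close> and \<open>q - p\<close> equal \<open>f ?R - f (a + q)\<close>, and the
      coefficients add up to \<open>q\<close>.\<close>
    then have "q * (v * (f ?R - f (a + p))) < q * (w * (f ?R - f (a + q)))"
      using pos by simp
    then have "0 < w * (p * (f ?R - f (a + q)) + (q - p) * (f ?R - f (?R - p)))
        - v * q * (f ?R - f (a + p))"
      by (simp add: algebra_simps)
    also have "\<dots> \<le> w * (p * (f T - f (a + q)) + (q - p) * (f T - f (T - p)))
        - v * q * (f T - f (a + p))"
      using gain_mono[OF assms(1,2) pos, of ?R T "f (a + q)" "f (a + p)"] assms(3,7)
        \<open>0 \<le> a\<close> \<open>0 \<le> b\<close> pos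
      by (simp add: T_def flip: defs)
    finally show False using upper by simp
  qed
qed

end
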